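(* According to relative worst order analysis, Maj and Eag are incomparable.
   Context: Online frequent items problem: an input sequence is $I=a_1,\ldots,a_n$ of items from an infinite universe, $n=|I|$. An algorithm maintains a buffer holding one item; $s_t$ is the buffer content after step $t$; at step $1$ the buffer receives $a_1$, and at each later step $t$ the algorithm either keeps $s_{t-1}$ or replaces it by $a_t$. With $f_I(a)=|\{i:a_i=a\}|/n$, the aggregate frequency of $\mathcal A$ on $I$ is $\mathcal A(I)=\sum_{t=1}^n f_I(s^{\mathcal A}_t)$ (to be maximized). Maj keeps a counter, initially $0$: when an item arrives, if the counter is $0$ it buffers the item and sets the counter to $1$; otherwise, if the arriving item equals the buffered item the counter is incremented, else it is decremented (buffer unchanged). Eag: let $t^*=\min\{t\in\{1,\ldots,n-1\}: a_t=a_{t+1}\}$ if such $t$ exists, else $t^*=n$; Eag sets $s_t=a_t$ for $t\le t^*$ and $s_t=a_{t^*}$ for $t>t^*$. For an algorithm $\mathcal A$, $\mathcal A_W(I)=\min_\sigma\mathcal A(\sigma(I))$ over all permutations $\sigma(I)$ of $I$. Relative worst order analysis: for a total order $\sqsubseteq\in\{\le,\ge\}$, $f$ is an $(\mathcal A,\mathcal B,\sqsubseteq)$-function if there is $h\in o(f)$ such that for all $I$ (with $n=|I|$), $\mathcal A_W(I)\sqsubseteq (f(n)+h(n))\,\mathcal B_W(I)$. $f$ is a bounding function with respect to $(\mathcal A,\mathcal B,\sqsubseteq)$ if it is an $(\mathcal A,\mathcal B,\sqsubseteq)$-function and for every $(\mathcal A,\mathcal B,\sqsubseteq)$-function $g$,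 $\lim_{n\to\infty} f(n)/g(n)\sqsubseteq 1$. If $f$ is a bounding function w.r.t. $(\mathcal A,\mathcal B,\le)$ and $g$ one w.r.t. $(\mathcal A,\mathcal B,\ge)$, then $\mathcal A$ and $\mathcal B$ are comparable if $\lim_{n\to\infty} f(n)\le 1$ or $\lim_{n\to\infty} g(n)\ge1$, and incomparable otherwise. *)

theory Defs
  imports
    Complex_Main
    "HOL-Library.Landau_Symbols"
    "HOL-Library.Liminf_Limsup"
    "HOL-Library.Extended_Real"
    "HOL-Combinatorics.Multiset_Permutations"
begin

text \<open>
  An input is a list \<open>I\<close>; its item \<open>a\<^sub>t\<close> is \<open>I ! (t - 1)\<close>. Steps \<open>t\<close> are counted from 1, and
  \<open>A I t\<close> is the buffer content of algorithm \<open>A\<close> after step \<open>t\<close>; it is meaningful only for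
  \<open>1 \<le> t \<le> length I\<close>.
\<close>

type_synonym 'a algorithm = "'a list \<Rightarrow> nat \<Rightarrow> 'a"

text \<open>The last conjunct says that a decision depends only on the items seen so far.\<close>

definition online_algorithm :: "'a algorithm \<Rightarrow> bool" where
  "online_algorithm A \<longleftrightarrow>
     (\<forall>I. I \<noteq> [] \<longrightarrow> A I 1 = I ! 0) \<and>
     (\<forall>I t. 1 < t \<and> t \<le> length I \<longrightarrow> A I t = A I (t - 1) \<or> A I t = I ! (t - 1)) \<and>
     (\<forall>I J t. 1 \<le> t \<and> t \<le> length I \<longrightarrow> A (I @ J) t = A I t)"

definition freq :: "'a list \<Rightarrow> 'a \<Rightarrow> real" where
  "freq I a = real (card {i. i < length I \<and> I ! i = a}) / real (length I)"

definition aggregate :: "'a algorithm \<Rightarrow> 'a list \<Rightarrow> real" where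
  "aggregate A I = (\<Sum>t = 1..length I. freq I (A I t))"

definition worst :: "'a algorithm \<Rightarrow> 'a list \<Rightarrow> real" where
  "worst A I = Min (aggregate A ` permutations_of_multiset (mset I))"

text \<open>
  The state is the buffered item together with the counter. The initial item is irrelevant,
  since it is overwritten in the first step.
\<close>

fun maj_state :: "'a list \<Rightarrow> nat \<Rightarrow> 'a \<times> nat" where
  "maj_state I 0 = (undefined, 0)"
| "maj_state I (Suc t) =
     (let (s, c) = maj_state I t; a = I ! t in
      if c = 0 then (a, 1) else if a = s then (s, c + 1) else (s, c - 1))"

definition Maj :: "'a algorithm" where
  "Maj I t = fst (maj_state I t)"

definition eag_stop :: "'a list \<Rightarrow> nat" where
  "eag_stop I =
     (let T = {t \<in> {1..<length I}. I ! (t - 1) = I ! t} in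
      if T = {} then length I else Min T)"

definition Eag :: "'a algorithm" where
  "Eag I t = (if t \<le> eag_stop I then I ! (t - 1) else I ! (eag_stop I - 1))"

text \<open>
  Relative worst order analysis. The relation \<open>R\<close> is either \<open>(\<le>)\<close> or \<open>(\<ge>)\<close>. The functions
  \<open>f\<close> are asymptotic growth rates, hence eventually positive; without this, the ratios below
  are not meaningful, as \<open>f = 0\<close> and negative \<open>f\<close> would trivially qualify for \<open>(\<ge>)\<close>.
\<close>

definition rwo_function ::
    "'a algorithm \<Rightarrow> 'a algorithm \<Rightarrow> (real \<Rightarrow> real \<Rightarrow> bool) \<Rightarrow> (nat \<Rightarrow> real) \<Rightarrow> bool" where
  "rwo_function A B R f \<longleftrightarrow>
     (\<forall>\<^sub>F n in sequentially. f n > 0) \<and>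
     (\<exists>h. h \<in> o(f) \<and>
        (\<forall>I. R (worst A I) ((f (length I) + h (length I)) * worst B I)))"

text \<open>
  The limit conditions ``at most 1'' and ``at least 1'' are stated with \<open>limsup\<close> and
  \<open>liminf\<close>. Existence of the limits of all the ratios \<open>f n / g n\<close> cannot be required: if \<open>f\<close> is
  an \<open>(A, B, \<le>)\<close>-function, then so is the function that equals \<open>f\<close> at even and \<open>2 * f\<close> at odd
  arguments, so there would be no bounding functions at all.
\<close>

definition upper_bounding :: "'a algorithm \<Rightarrow> 'a algorithm \<Rightarrow> (nat \<Rightarrow> real) \<Rightarrow> bool" where
  "upper_bounding A B f \<longleftrightarrow>
     rwo_function A B (\<le>) f \<and>
     (\<forall>g. rwo_function A B (\<le>) g \<longrightarrow> limsup (\<lambda>n. ereal (f n / g n)) \<le> 1)"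

definition lower_bounding :: "'a algorithm \<Rightarrow> 'a algorithm \<Rightarrow> (nat \<Rightarrow> real) \<Rightarrow> bool" where
  "lower_bounding A B f \<longleftrightarrow>
     rwo_function A B (\<ge>) f \<and>
     (\<forall>g. rwo_function A B (\<ge>) g \<longrightarrow> liminf (\<lambda>n. ereal (f n / g n)) \<ge> 1)"

definition rwo_comparable :: "'a algorithm \<Rightarrow> 'a algorithm \<Rightarrow> bool" where
  "rwo_comparable A B \<longleftrightarrow>
     (\<exists>f g. upper_bounding A B f \<and> lower_bounding A B g \<and>
        (limsup (\<lambda>n. ereal (f n)) \<le> 1 \<or> liminf (\<lambda>n. ereal (g n)) \<ge> 1))"

text \<open>Bounding functions must exist, so that incomparability cannot hold vacuously.\<close>

definition rwo_incomparable :: "'a algorithm \<Rightarrow> 'a algorithm \<Rightarrow> bool" where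
  "rwo_incomparable A B \<longleftrightarrow>
     (\<exists>f. upper_bounding A B f) \<and> (\<exists>g. lower_bounding A B g) \<and> \<not> rwo_comparable A B"

text \<open>
  \<open>Maj\<close> and \<open>Eag\<close> are online algorithms in the sense above. For \<open>Eag\<close> this is not obvious from
  the definition, which inspects \<open>a\<^bsub>t+1\<^esub>\<close> to decide whether to stop at step \<open>t\<close>.
\<close>

lemma maj_state_append: "t \<le> length I \<Longrightarrow> maj_state (I @ J) t = maj_state I t"
  by (induction t) (auto simp: nth_append)

lemma online_Maj: "online_algorithm Maj"
proof -
  have "Maj I t = Maj I (t - 1) \<or> Maj I t = I ! (t - 1)" if "1 < t" for t and I :: "'a list"
    using that by (cases t) (auto simp: Maj_def Let_def split: prod.splits)
  then show ?thesis
    by (auto simp: online_algorithm_def Maj_def maj_state_append)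
qed

lemma Eag_append:
  assumes "1 \<le> t" "t \<le> length I"
  shows "Eag (I @ J) t = Eag I t"
proof -
  define S where "S K = {t \<in> {1..<length K}. K ! (t - 1) = K ! t}" for K :: "'a list"
  have fin: "finite (S K)" for K unfolding S_def by simp
  have stop: "eag_stop K = (if S K = {} then length K else Min (S K))" for K
    unfolding eag_stop_def S_def Let_def by (rule refl)
  have sub: "s \<in> S (I @ J) \<longleftrightarrow> s \<in> S I" if "s < length I" for s
    using that by (auto simp: S_def nth_append)
  have less: "s < length K" if "s \<in> S K" for s K
    using that by (simp add: S_def)
  show ?thesis
  proof (cases "S I = {}")
    case True
    then have "s \<ge> length I" if "s \<in> S (I @ J)" for s
      using sub[of s] that by (metis empty_iff not_le_imp_less)
    then have "eag_stop (I @ J) \<ge> length I"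
      using fin by (cases "S (I @ J) = {}") (simp_all add: stop)
    then show ?thesis
      using assms True by (cases t) (auto simp: Eag_def stop nth_append)
  next
    case False
    define m where "m = Min (S I)"
    have m: "m \<in> S I" "\<And>s. s \<in> S I \<Longrightarrow> m \<le> s"
      using False fin by (auto simp: m_def)
    have "m \<in> S (I @ J)" using m(1) sub less by blast
    moreover have "m \<le> s" if "s \<in> S (I @ J)" for s
      using m sub less that by (metis le_less_linear order.strict_trans2 less_imp_le)
    ultimately have "Min (S (I @ J)) = m" using fin by (intro Min_eqI) auto
    then have "eag_stop (I @ J) = m" "eag_stop I = m"
      using \<open>m \<in> S (I @ J)\<close> False by (auto simp: stop m_def)
    then show ?thesis
      using assms less[OF m(1)] by (auto simp: Eag_def nth_append)
  qed
qed

lemma online_Eag: "online_algorithm Eag"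
proof -
  have "Eag I t = Eag I (t - 1) \<or> Eag I t = I ! (t - 1)" if "1 < t" for t and I :: "'a list"
    using that by (cases "t = Suc (eag_stop I)") (auto simp: Eag_def)
  moreover have "Eag I 1 = I ! 0" if "I \<noteq> []" for I :: "'a list"
    by (auto simp: Eag_def not_le)
  ultimately show ?thesis
    by (auto simp: online_algorithm_def Eag_append)
qed

end

theory Submission imports Defs begin

text \<open>
  Both worst-order values of a nonempty input of length \<open>n\<close> lie between 1 and \<open>n\<close>, so the
  supremum and the infimum of their ratio over all inputs of length \<open>n\<close> are bounding functions.
  Incomparability then only needs two families of inputs. If \<open>a\<close> occurs \<open>n - 2\<close> times and \<open>b\<close>
  twice, then Eag may be locked on \<open>b\<close>, whereas Maj holds \<open>b\<close> during at most four steps. If \<open>a\<close>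
  occurs \<open>m\<close> times among \<open>m\<close> further items that occur only once, then Eag holds \<open>a\<close> during at
  least \<open>m\<close> steps, whereas Maj never holds \<open>a\<close> on an alternating order.
\<close>

section \<open>Worst-order values\<close>

lemma count_mset_eq_card: "count (mset I) a = card {i. i < length I \<and> I ! i = a}"
proof -
  have "count (mset I) a = length (filter (\<lambda>x. x = a) I)"
    by (induction I) auto
  then show ?thesis by (simp add: length_filter_conv_card)
qed

lemma freq_eq_count: "freq I a = real (count (mset I) a) / real (length I)"
  by (simp add: freq_def count_mset_eq_card)

lemma freq_nonneg: "0 \<le> freq I a"
  by (simp add: freq_def)

lemma freq_le_1: "freq I a \<le> 1"
  using count_le_size[of "mset I" a] by (auto simp: freq_eq_count divide_le_eq_1)

lemma freq_ge_inverse_length: "a \<in> set I \<Longrightarrow> 1 / real (length I) \<le> freq I a"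
  by (auto simp: freq_eq_count Suc_le_eq intro!: divide_right_mono)

lemma worst_le_aggregate: "mset J = mset I \<Longrightarrow> worst A I \<le> aggregate A J"
  unfolding worst_def by (rule Min_le) (auto intro!: imageI permutations_of_multisetI)

lemma worst_geI:
  assumes "\<And>J. mset J = mset I \<Longrightarrow> x \<le> aggregate A J"
  shows "x \<le> worst A I"
  unfolding worst_def using assms by (subst Min_ge_iff) (auto dest: permutations_of_multisetD)

lemma worst_Nil: "worst A [] = 0"
  by (simp add: worst_def aggregate_def)

lemma worst_le_length: "worst A I \<le> real (length I)"
proof -
  have "aggregate A I \<le> (\<Sum>t = 1..length I. 1)"
    unfolding aggregate_def by (intro sum_mono freq_le_1)
  then show ?thesis
    using worst_le_aggregate[OF refl, of A I] by simp
qed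

lemma online_algorithm_in_set:
  assumes "online_algorithm A" "1 \<le> t" "t \<le> length I"
  shows "A I t \<in> set I"
  using assms(2,3)
proof (induction t rule: dec_induct)
  case base
  then show ?case
    using assms(1) nth_mem[of 0 I] by (cases I) (auto simp: online_algorithm_def)
next
  case (step t)
  have "A I (Suc t) = A I t \<or> A I (Suc t) = I ! t"
    using assms(1) step unfolding online_algorithm_def
    by (metis One_nat_def diff_Suc_1 le_imp_less_Suc)
  then show ?case
    using step by auto
qed

text \<open>The buffered item always occurs in the input, so each of the n steps contributes at
  least 1/n. This positivity later justifies dividing by worst-order values.\<close>

lemma worst_ge_1:
  assumes "online_algorithm A" "I \<noteq> []"
  shows "1 \<le> worst A I"
proof (rule worst_geI)
  fix J assume J: "mset J = mset I"
  then have ne: "length J > 0" using assms(2) by (cases J) auto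
  have "(\<Sum>t = 1..length J. 1 / real (length J)) \<le> aggregate A J"
    unfolding aggregate_def
    by (intro sum_mono freq_ge_inverse_length online_algorithm_in_set assms) auto
  then show "1 \<le> aggregate A J" using ne by simp
qed

lemma aggregate_ge_card:
  "real (card {t \<in> {1..length I}. A I t = a}) * freq I a \<le> aggregate A I"
proof -
  have "(\<Sum>t \<in> {t \<in> {1..length I}. A I t = a}. freq I (A I t)) \<le> aggregate A I"
    unfolding aggregate_def by (intro sum_mono2) (auto simp: freq_nonneg)
  then show ?thesis by simp
qed

section \<open>Existence and limits of bounding functions\<close>

text \<open>Since \<open>f\<close> is eventually positive, little-o becomes a plain inequality
  without absolute values around \<open>f\<close>; all later estimates use the error in this
  form.\<close>

lemma rwo_function_small_error:
  assumes "rwo_function A B R f"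
  obtains h where "\<And>I. R (worst A I) ((f (length I) + h (length I)) * worst B I)"
    and "\<And>e. e > 0 \<Longrightarrow> \<forall>\<^sub>F n in sequentially. 0 < f n \<and> \<bar>h n\<bar> \<le> e * f n"
proof -
  obtain h where h: "h \<in> o(f)" "\<And>I. R (worst A I) ((f (length I) + h (length I)) * worst B I)"
    and pos: "\<forall>\<^sub>F n in sequentially. f n > 0"
    using assms by (auto simp: rwo_function_def)
  have "\<forall>\<^sub>F n in sequentially. 0 < f n \<and> \<bar>h n\<bar> \<le> e * f n" if "e > 0" for e
    using landau_o.smallD[OF h(1) that] pos by eventually_elim auto
  with h(2) show thesis using that by blast
qed

text \<open>There may be infinitely many inputs of a given length; these bounds make the supremum
  and infimum of the ratios over them finite and positive.\<close>

lemma worst_ratio_bounds: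
  assumes "online_algorithm A" "online_algorithm B" "I \<noteq> []"
  shows "worst A I / worst B I \<le> real (length I)"
    and "1 / real (length I) \<le> worst A I / worst B I"
proof -
  note ge = worst_ge_1[OF assms(1,3)] worst_ge_1[OF assms(2,3)]
  have "worst A I / worst B I \<le> real (length I) / 1"
    using worst_le_length[of A I] ge by (intro frac_le) auto
  then show "worst A I / worst B I \<le> real (length I)" by simp
  show "1 / real (length I) \<le> worst A I / worst B I"
    using worst_le_length[of B I] ge by (intro frac_le) auto
qed

text \<open>The pointwise supremum of the ratios works with zero error. For any competitor
  \<open>g\<close> with error \<open>h\<close>, the sum g + h bounds every ratio of length n, hence
  also the supremum, and \<open>h\<close> is negligible against \<open>g\<close>.\<close>

lemma ex_upper_bounding:
  fixes A B :: "'a algorithm"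
  assumes "online_algorithm A" "online_algorithm B"
  shows "\<exists>f. upper_bounding A B f"
proof -
  define f where "f n = (SUP I \<in> {I. length I = n}. worst A I / worst B I)" for n
  have ne: "{I :: 'a list. length I = n} \<noteq> {}" for n
    by (auto intro!: exI[of _ "replicate n undefined"])
  have upper: "worst A I / worst B I \<le> f (length I)" if "I \<noteq> []" for I
    unfolding f_def
  proof (rule cSUP_upper)
    show "bdd_above ((\<lambda>I. worst A I / worst B I) ` {J. length J = length I})"
    proof (rule bdd_aboveI2)
      fix J :: "'a list" assume "J \<in> {J. length J = length I}"
      then show "worst A J / worst B J \<le> real (length I)"
        using that worst_ratio_bounds(1)[OF assms, of J] by (cases "J = []") auto
    qed
  qed auto
  have pos: "f n > 0" if "n > 0" for n
  proof -
    let ?I = "replicate n undefined :: 'a list"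
    have "?I \<noteq> []" using that by simp
    with upper[OF this] worst_ratio_bounds(2)[OF assms this] that
    show ?thesis by (auto intro: order.strict_trans2[of 0 "1 / real n"])
  qed
  \<comment> \<open>On the empty input both sides are 0, whatever the value of
    \<open>f 0\<close>.\<close>
  have "worst A I \<le> f (length I) * worst B I" for I
  proof (cases "I = []")
    case False
    then show ?thesis
      using upper[OF False] worst_ge_1[OF assms(2) False] by (simp add: pos_divide_le_eq)
  qed (simp add: worst_Nil)
  then have "rwo_function A B (\<le>) f"
    using eventually_mono[OF eventually_gt_at_top[of 0] pos]
    by (auto simp: rwo_function_def intro!: exI[of _ "\<lambda>_. 0"])
  moreover have "limsup (\<lambda>n. ereal (f n / g n)) \<le> 1" if rwo_g: "rwo_function A B (\<le>) g" for g
  proof -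
    obtain h where h: "\<And>I. worst A I \<le> (g (length I) + h (length I)) * worst B I"
      and small: "\<And>e. e > 0 \<Longrightarrow> \<forall>\<^sub>F n in sequentially. 0 < g n \<and> \<bar>h n\<bar> \<le> e * g n"
      using rwo_function_small_error[OF rwo_g] by blast
    have le: "f n \<le> g n + h n" if "n > 0" for n
      unfolding f_def
    proof (rule cSUP_least[OF ne])
      fix I :: "'a list" assume "I \<in> {I. length I = n}"
      then show "worst A I / worst B I \<le> g n + h n"
        using h[of I] worst_ge_1[OF assms(2), of I] that by (auto simp: pos_divide_le_eq)
    qed
    show ?thesis
    proof (rule ereal_le_epsilon2)
      fix e :: real assume "0 < e"
      from small[OF this] eventually_gt_at_top[of 0]
      have "\<forall>\<^sub>F n in sequentially. ereal (f n / g n) \<le> 1 + ereal e"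
      proof eventually_elim
        case (elim n)
        then have "f n \<le> (1 + e) * g n" using le[of n] by (auto simp: algebra_simps)
        then show ?case using elim by (simp add: pos_divide_le_eq one_ereal_def)
      qed
      then show "limsup (\<lambda>n. ereal (f n / g n)) \<le> 1 + ereal e" by (rule Limsup_bounded)
    qed
  qed
  ultimately show ?thesis by (auto simp: upper_bounding_def)
qed

text \<open>Dual to the upper case, with the pointwise infimum.\<close>

lemma ex_lower_bounding:
  fixes A B :: "'a algorithm"
  assumes "online_algorithm A" "online_algorithm B"
  shows "\<exists>f. lower_bounding A B f"
proof -
  define f where "f n = (INF I \<in> {I. length I = n}. worst A I / worst B I)" for n
  have ne: "{I :: 'a list. length I = n} \<noteq> {}" for n
    by (auto intro!: exI[of _ "replicate n undefined"])
  have lower: "f (length I) \<le> worst A I / worst B I" if "I \<noteq> []" for I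
    unfolding f_def
  proof (rule cINF_lower)
    show "bdd_below ((\<lambda>I. worst A I / worst B I) ` {J. length J = length I})"
    proof (rule bdd_belowI2)
      fix J :: "'a list" assume "J \<in> {J. length J = length I}"
      then show "1 / real (length I) \<le> worst A J / worst B J"
        using that worst_ratio_bounds(2)[OF assms, of J] by (cases "J = []") auto
    qed
  qed auto
  have pos: "f n > 0" if "n > 0" for n
  proof -
    \<comment> \<open>An infimum of positive ratios could still be 0, so a bound uniform in the
      input is used.\<close>
    have "1 / real n \<le> f n"
      unfolding f_def using that worst_ratio_bounds(2)[OF assms]
      by (intro cINF_greatest[OF ne]) auto
    then show ?thesis using that by (auto intro: order.strict_trans2[of 0 "1 / real n"])
  qed
  have "worst A I \<ge> f (length I) * worst B I" for I
  proof (cases "I = []")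
    case False
    then show ?thesis
      using lower[OF False] worst_ge_1[OF assms(2) False] by (simp add: pos_le_divide_eq)
  qed (simp add: worst_Nil)
  then have "rwo_function A B (\<ge>) f"
    using eventually_mono[OF eventually_gt_at_top[of 0] pos]
    by (auto simp: rwo_function_def intro!: exI[of _ "\<lambda>_. 0"])
  moreover have "liminf (\<lambda>n. ereal (f n / g n)) \<ge> 1" if rwo_g: "rwo_function A B (\<ge>) g" for g
  proof -
    obtain h where h: "\<And>I. worst A I \<ge> (g (length I) + h (length I)) * worst B I"
      and small: "\<And>e. e > 0 \<Longrightarrow> \<forall>\<^sub>F n in sequentially. 0 < g n \<and> \<bar>h n\<bar> \<le> e * g n"
      using rwo_function_small_error[OF rwo_g] by blast
    have ge: "f n \<ge> g n + h n" if "n > 0" for n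
      unfolding f_def
    proof (rule cINF_greatest[OF ne])
      fix I :: "'a list" assume "I \<in> {I. length I = n}"
      then show "worst A I / worst B I \<ge> g n + h n"
        using h[of I] worst_ge_1[OF assms(2), of I] that by (auto simp: pos_le_divide_eq)
    qed
    show ?thesis
    proof (rule ereal_le_epsilon2)
      fix e :: real assume "0 < e"
      from small[OF this] eventually_gt_at_top[of 0]
      have "\<forall>\<^sub>F n in sequentially. ereal (1 - e) \<le> ereal (f n / g n)"
      proof eventually_elim
        case (elim n)
        then have "(1 - e) * g n \<le> f n" using ge[of n] by (auto simp: algebra_simps)
        then show ?case using elim by (simp add: pos_le_divide_eq)
      qed
      then have "ereal (1 - e) \<le> liminf (\<lambda>n. ereal (f n / g n))" by (rule Liminf_bounded)
      then have "ereal (1 - e) + ereal e \<le> liminf (\<lambda>n. ereal (f n / g n)) + ereal e"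
        by (rule add_right_mono)
      then show "1 \<le> liminf (\<lambda>n. ereal (f n / g n)) + ereal e" by (simp add: one_ereal_def)
    qed
  qed
  ultimately show ?thesis by (auto simp: lower_bounding_def)
qed

section \<open>Limits forced by families of inputs\<close>

text \<open>If the limsup were below \<open>c\<close>, then f + h would eventually stay below
  \<open>c\<close> too, contradicting an input of large length with ratio at least \<open>c\<close>.
  Infinitely many lengths suffice, so a family need not cover every n.\<close>

lemma limsup_rwo_function_ge:
  assumes "rwo_function A B (\<le>) f"
    and "\<exists>\<^sub>F n in sequentially. \<exists>I. length I = n \<and> 0 < worst B I \<and> c * worst B I \<le> worst A I"
  shows "ereal c \<le> limsup (\<lambda>n. ereal (f n))"
proof (rule ccontr)
  assume "\<not> ?thesis"
  then obtain d where d: "limsup (\<lambda>n. ereal (f n)) < ereal d" "d < c"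
    using ereal_dense2[of "limsup (\<lambda>n. ereal (f n))" "ereal c"] by (auto simp: not_le)
  obtain h where h: "\<And>I. worst A I \<le> (f (length I) + h (length I)) * worst B I"
    and small: "\<And>e. e > 0 \<Longrightarrow> \<forall>\<^sub>F n in sequentially. 0 < f n \<and> \<bar>h n\<bar> \<le> e * f n"
    using rwo_function_small_error[OF assms(1)] by blast
  have less: "\<forall>\<^sub>F n in sequentially. f n < d"
    using Limsup_lessD[OF d(1)] by simp
  \<comment> \<open>Eventually 0 < f n < d; the conclusion no longer depends on n.\<close>
  have "\<forall>\<^sub>F n in sequentially. 0 < d"
    using less small[OF zero_less_one] by eventually_elim auto
  then have "0 < d" by simp
  \<comment> \<open>This relative error is chosen so that d * (1 + (c - d) / d) = c.\<close>
  then have "(c - d) / d > 0" using d(2) by simp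
  from small[OF this] less have "\<forall>\<^sub>F n in sequentially. f n + h n < c"
  proof eventually_elim
    case (elim n)
    have "f n + h n \<le> f n * (1 + (c - d) / d)"
      using elim by (auto simp: algebra_simps)
    also have "\<dots> < d * (1 + (c - d) / d)"
      using elim \<open>(c - d) / d > 0\<close> by (intro mult_strict_right_mono) auto
    also have "\<dots> = c" using \<open>0 < d\<close> by (simp add: field_simps)
    finally show ?case .
  qed
  from frequently_ex[OF frequently_eventually_frequently[OF assms(2) this]]
  obtain I where I: "f (length I) + h (length I) < c" "0 < worst B I" "c * worst B I \<le> worst A I"
    by blast
  with h[of I] mult_strict_right_mono[OF I(1,2)] show False by linarith
qed

lemma liminf_rwo_function_le:
  assumes "rwo_function A B (\<ge>) f" "0 < c"
    and "\<exists>\<^sub>F n in sequentially. \<exists>I. length I = n \<and> 0 < worst B I \<and> worst A I \<le> c * worst B I"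
  shows "liminf (\<lambda>n. ereal (f n)) \<le> ereal c"
proof (rule ccontr)
  assume "\<not> ?thesis"
  then obtain d where d: "ereal d < liminf (\<lambda>n. ereal (f n))" "c < d"
    using ereal_dense2[of "ereal c" "liminf (\<lambda>n. ereal (f n))"] by (auto simp: not_le)
  obtain h where h: "\<And>I. worst A I \<ge> (f (length I) + h (length I)) * worst B I"
    and small: "\<And>e. e > 0 \<Longrightarrow> \<forall>\<^sub>F n in sequentially. 0 < f n \<and> \<bar>h n\<bar> \<le> e * f n"
    using rwo_function_small_error[OF assms(1)] by blast
  have greater: "\<forall>\<^sub>F n in sequentially. d < f n"
    using less_LiminfD[OF d(1)] by simp
  \<comment> \<open>With this relative error, f + h is at least f * (c / d), which exceeds
    \<open>c\<close> because f > d.\<close>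
  have "0 < d" "(d - c) / d > 0" using d(2) \<open>0 < c\<close> by auto
  from small[OF this(2)] greater have "\<forall>\<^sub>F n in sequentially. c < f n + h n"
  proof eventually_elim
    case (elim n)
    have "c = d * (c / d)" using \<open>0 < d\<close> by simp
    also have "\<dots> < f n * (c / d)"
      using elim \<open>0 < c\<close> \<open>0 < d\<close> by (intro mult_strict_right_mono) auto
    also have "\<dots> = f n - (d - c) / d * f n" using \<open>0 < d\<close> by (simp add: field_simps)
    also have "\<dots> \<le> f n + h n" using elim by auto
    finally show ?case .
  qed
  from frequently_ex[OF frequently_eventually_frequently[OF assms(3) this]]
  obtain I where I: "c < f (length I) + h (length I)" "0 < worst B I" "worst A I \<le> c * worst B I"
    by blast
  with h[of I] mult_strict_right_mono[OF I(1,2)] show False by linarith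
qed

section \<open>Inputs that separate Maj and Eag\<close>

text \<open>
  Each unit of the counter of a buffered item other than \<open>a\<close> may pay for one later step in which
  that item stays in the buffer, hence the counter on the left-hand side.
\<close>

lemma Maj_not_majority_steps:
  assumes "t \<le> length I"
  shows "card {s \<in> {1..t}. Maj I s \<noteq> a} + (if Maj I t \<noteq> a then snd (maj_state I t) else 0)
     \<le> 2 * length (filter (\<lambda>x. x \<noteq> a) (take t I))"
  using assms
proof (induction t)
  case (Suc t)
  have steps: "card {s \<in> {1..Suc t}. Maj I s \<noteq> a} =
      card {s \<in> {1..t}. Maj I s \<noteq> a} + (if Maj I (Suc t) \<noteq> a then 1 else 0)"
  proof -
    have "{s \<in> {1..Suc t}. Maj I s \<noteq> a} =
        {s \<in> {1..t}. Maj I s \<noteq> a} \<union> (if Maj I (Suc t) \<noteq> a then {Suc t} else {})"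
      by (auto simp: le_Suc_eq)
    then show ?thesis by (auto simp: card_insert_if)
  qed
  have taken: "take (Suc t) I = take t I @ [I ! t]"
    using Suc.prems by (simp add: take_Suc_conv_app_nth)
  obtain x c where xc: "maj_state I t = (x, c)" by fastforce
  have IH: "card {s \<in> {1..t}. Maj I s \<noteq> a} + (if x \<noteq> a then c else 0)
      \<le> 2 * length (filter (\<lambda>x. x \<noteq> a) (take t I))"
    using Suc xc by (simp add: Maj_def split: if_splits)
  have "maj_state I (Suc t) = (if c = 0 then (I ! t, 1)
      else if I ! t = x then (x, c + 1) else (x, c - 1))"
    using xc by (simp add: Let_def)
  \<comment> \<open>An arriving item other than \<open>a\<close> raises the right-hand side by 2,
    enough for one step and one unit of counter. An arriving \<open>a\<close> that leaves another
    item buffered trades one unit of counter for one step.\<close>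
  then show ?case
    unfolding steps taken using IH by (auto simp: Maj_def split: if_splits)
qed simp

text \<open>At most 2k steps hold an item other than \<open>a\<close>; the remaining ones contribute
  \<open>freq I a\<close> each.\<close>

lemma Maj_aggregate_ge:
  assumes "length (filter (\<lambda>x. x \<noteq> a) I) \<le> k"
  shows "(real (length I) - 2 * real k) * freq I a \<le> aggregate Maj I"
proof -
  have "card {t \<in> {1..length I}. Maj I t = a} + card {t \<in> {1..length I}. Maj I t \<noteq> a}
      = card ({t \<in> {1..length I}. Maj I t = a} \<union> {t \<in> {1..length I}. Maj I t \<noteq> a})"
    by (subst card_Un_disjoint) auto
  also have "{t \<in> {1..length I}. Maj I t = a} \<union> {t \<in> {1..length I}. Maj I t \<noteq> a} = {1..length I}"
    by auto
  finally have "length I \<le> card {t \<in> {1..length I}. Maj I t = a} + 2 * k"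
    using Maj_not_majority_steps[of "length I" I a] assms by simp
  then have "(real (length I) - 2 * real k) * freq I a
      \<le> real (card {t \<in> {1..length I}. Maj I t = a}) * freq I a"
    by (intro mult_right_mono freq_nonneg) simp
  also have "\<dots> \<le> aggregate Maj I" by (rule aggregate_ge_card)
  finally show ?thesis .
qed

section \<open>Two copies of one item against many of another\<close>

lemma Eag_stop_Cons_Cons: "eag_stop (b # b # I) = 1"
proof -
  have "Min {t \<in> {1..<length (b # b # I)}. (b # b # I) ! (t - 1) = (b # b # I) ! t} = 1"
    by (rule Min_eqI) auto
  moreover have "1 \<in> {t \<in> {1..<length (b # b # I)}. (b # b # I) ! (t - 1) = (b # b # I) ! t}"
    by simp
  ultimately show ?thesis unfolding eag_stop_def Let_def by auto
qed

text \<open>Eag is locked on \<open>b\<close> from the first step; n steps of weight count / n add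
  up to the count.\<close>

lemma Eag_aggregate_Cons_Cons:
  "aggregate Eag (b # b # I) = real (count (mset (b # b # I)) b)"
proof -
  have "Eag (b # b # I) t = b" if "1 \<le> t" for t
    using that by (auto simp: Eag_def Eag_stop_Cons_Cons)
  then have "aggregate Eag (b # b # I) = (\<Sum>t = 1..length (b # b # I). freq (b # b # I) b)"
    unfolding aggregate_def by (intro sum.cong) auto
  also have "\<dots> = real (count (mset (b # b # I)) b)"
    by (simp add: freq_eq_count del: count_add_mset)
  finally show ?thesis .
qed

text \<open>The displayed order costs Eag down to 2, while Maj earns at least (m - 2) * m / (m + 2)
  on every order. The least natural number m for which this reaches 4 is 8.\<close>

lemma Maj_worst_beats_Eag_worst:
  fixes a b :: 'a
  assumes "a \<noteq> b" "8 \<le> m"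
  defines "I \<equiv> b # b # replicate m a"
  shows "2 * worst Eag I \<le> worst Maj I"
proof -
  have "worst Eag I \<le> 2"
    using worst_le_aggregate[OF refl, of Eag I] Eag_aggregate_Cons_Cons[of b "replicate m a"]
      assms(1) by (auto simp: I_def)
  moreover have "4 \<le> worst Maj I"
  proof (rule worst_geI)
    fix J assume J: "mset J = mset I"
    have "length (filter (\<lambda>x. x \<noteq> a) J) = size (filter_mset (\<lambda>x. x \<noteq> a) (mset J))"
      by (metis mset_filter size_mset)
    also have "\<dots> = 2" using assms(1) by (simp add: J I_def)
    finally have "(real (length J) - 2 * real 2) * freq J a \<le> aggregate Maj J"
      by (intro Maj_aggregate_ge) simp
    moreover have "length J = m + 2" using mset_eq_length[OF J] by (simp add: I_def)
    moreover have "count (mset J) a = m" using assms(1) by (simp add: J I_def)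
    ultimately have "(real m - 2) * (real m / (real m + 2)) \<le> aggregate Maj J"
      by (simp add: freq_eq_count add.commute)
    moreover have "4 \<le> (real m - 2) * (real m / (real m + 2))"
    proof -
      have m: "8 \<le> real m" using assms(2) by simp
      then have "8 * real m \<le> real m * real m" by (intro mult_right_mono) auto
      with m have "4 * (real m + 2) \<le> real m * real m - 2 * real m"
        by argo
      then have "4 * (real m + 2) \<le> (real m - 2) * real m"
        by (simp only: left_diff_distrib)
      then show ?thesis by (simp add: pos_le_divide_eq)
    qed
    ultimately show "4 \<le> aggregate Maj J" by linarith
  qed
  ultimately show ?thesis by simp
qed

section \<open>One repeated item among items that occur once\<close>

text \<open>Before stopping, Eag buffers the current item, here \<open>a\<close>. Once past the
  stopping step, it holds an item with two adjacent occurrences, and only \<open>a\<close> occurs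
  twice.\<close>

lemma Eag_keeps_repeated:
  assumes "\<And>x. x \<noteq> a \<Longrightarrow> count (mset I) x \<le> 1" "1 \<le> t" "t \<le> length I" "I ! (t - 1) = a"
  shows "Eag I t = a"
proof (cases "t \<le> eag_stop I")
  case False
  define T where "T = {t \<in> {1..<length I}. I ! (t - 1) = I ! t}"
  have "eag_stop I = (if T = {} then length I else Min T)"
    unfolding eag_stop_def T_def Let_def by (rule refl)
  with False assms(3) have "T \<noteq> {}" "eag_stop I = Min T" by (auto split: if_splits)
  moreover have "finite T" by (simp add: T_def)
  ultimately have "eag_stop I \<in> T" by simp
  then obtain s where s: "eag_stop I = Suc s" "Suc s < length I" "I ! s = I ! Suc s"
    by (cases "eag_stop I") (auto simp: T_def)
  \<comment> \<open>Exposing the two adjacent equal items lets the count be bounded below by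
    2.\<close>
  have "I = take s I @ I ! s # I ! Suc s # drop (Suc (Suc s)) I"
    using s(2) by (simp add: Cons_nth_drop_Suc)
  then have "count (mset I) (I ! s) =
      count (mset (take s I @ I ! s # I ! Suc s # drop (Suc (Suc s)) I)) (I ! s)"
    by (rule arg_cong)
  then have "2 \<le> count (mset I) (I ! s)"
    using s(3) by simp
  then have "I ! s = a" using assms(1)[of "I ! s"] by force
  with s False show ?thesis by (simp add: Eag_def)
qed (use assms in \<open>simp add: Eag_def\<close>)

lemma Eag_aggregate_ge:
  assumes "\<And>x. x \<noteq> a \<Longrightarrow> count (mset I) x \<le> 1"
  shows "real (count (mset I) a) * freq I a \<le> aggregate Eag I"
proof -
  have "count (mset I) a = card {i. i < length I \<and> I ! i = a}"
    by (rule count_mset_eq_card)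
  \<comment> \<open>\<open>Suc\<close> turns list positions, counted from 0, into steps, counted
    from 1.\<close>
  also have "\<dots> = card (Suc ` {i. i < length I \<and> I ! i = a})"
    by (simp add: card_image)
  also have "\<dots> \<le> card {t \<in> {1..length I}. Eag I t = a}"
    using Eag_keeps_repeated[OF assms] by (intro card_mono) auto
  finally have "real (count (mset I) a) * freq I a
      \<le> real (card {t \<in> {1..length I}. Eag I t = a}) * freq I a"
    by (intro mult_right_mono freq_nonneg) simp
  also have "\<dots> \<le> aggregate Eag I" by (rule aggregate_ge_card)
  finally show ?thesis .
qed

text \<open>The bad order for Maj: each \<open>a\<close> arrives when another item has counter 1, so
  it only cancels that counter and is never buffered.\<close>

fun interleave_const :: "'a \<Rightarrow> 'a list \<Rightarrow> 'a list" where
  "interleave_const a [] = []"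
| "interleave_const a (x # xs) = x # a # interleave_const a xs"

lemma mset_interleave_const:
  "mset (interleave_const a xs) = mset xs + replicate_mset (length xs) a"
  by (induction xs) auto

lemma length_interleave_const: "length (interleave_const a xs) = 2 * length xs"
  by (induction xs) auto

lemma interleave_const_nth:
  assumes "i < length xs"
  shows "interleave_const a xs ! (2 * i) = xs ! i" "interleave_const a xs ! Suc (2 * i) = a"
proof -
  have "interleave_const a xs ! (2 * i) = xs ! i \<and> interleave_const a xs ! Suc (2 * i) = a"
    using assms
  proof (induction xs arbitrary: i)
    case (Cons x xs)
    then show ?case by (cases i) auto
  qed simp
  then show "interleave_const a xs ! (2 * i) = xs ! i" "interleave_const a xs ! Suc (2 * i) = a"
    by blast+
qed

text \<open>Each pair brings the counter from 0 to 1 and back to 0, so the next entry of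
  \<open>xs\<close> is buffered. Both steps of a pair are stated jointly since the second one starts
  the next pair in the induction.\<close>

lemma maj_state_interleave_const:
  assumes "a \<notin> set xs" "i < length xs"
  shows "maj_state (interleave_const a xs) (Suc (2 * i)) = (xs ! i, 1)
    \<and> maj_state (interleave_const a xs) (Suc (Suc (2 * i))) = (xs ! i, 0)"
  using assms(2)
proof (induction i)
  case 0
  then show ?case
    using interleave_const_nth[of 0 xs a] assms(1) nth_mem[of 0 xs] by (auto simp: Let_def)
next
  case (Suc i)
  then have "maj_state (interleave_const a xs) (2 * Suc i) = (xs ! i, 0)"
    by (simp del: maj_state.simps)
  then have "maj_state (interleave_const a xs) (Suc (2 * Suc i)) = (xs ! Suc i, 1)"
    using interleave_const_nth(1)[OF Suc.prems, of a]
    by (subst maj_state.simps) (simp del: maj_state.simps)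
  moreover from this
  have "maj_state (interleave_const a xs) (Suc (Suc (2 * Suc i))) = (xs ! Suc i, 0)"
    using interleave_const_nth(2)[OF Suc.prems, of a] assms(1) nth_mem[OF Suc.prems]
    by (subst maj_state.simps) (auto simp del: maj_state.simps)
  ultimately show ?case by blast
qed

lemma Maj_interleave_const:
  assumes "a \<notin> set xs" "1 \<le> t" "t \<le> 2 * length xs"
  shows "Maj (interleave_const a xs) t \<in> set xs"
proof -
  define i where "i = (t - 1) div 2"
  have "i < length xs" "t = Suc (2 * i) \<or> t = Suc (Suc (2 * i))"
    using assms(2,3) unfolding i_def by presburger+
  then show ?thesis
    using maj_state_interleave_const[OF assms(1)] by (auto simp: Maj_def simp del: maj_state.simps)
qed

text \<open>With m = \<open>length xs\<close>, Maj on the alternating order collects 2m times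
  1/(2m), that is 1. Eag collects at least m times 1/2 on every order, which is at least 2 once m is
  at least 4.\<close>

lemma Eag_worst_beats_Maj_worst:
  assumes "distinct xs" "a \<notin> set xs" "4 \<le> length xs"
  defines "I \<equiv> interleave_const a xs"
  shows "worst Maj I \<le> 1 / 2 * worst Eag I"
proof -
  have count: "count (mset I) x = (if x = a then length xs else if x \<in> set xs then 1 else 0)" for x
    using assms(1,2) by (auto simp: I_def mset_interleave_const distinct_count_atmost_1
        not_in_iff[symmetric])
  have len: "length I = 2 * length xs" by (simp add: I_def length_interleave_const)
  have "aggregate Maj I = (\<Sum>t = 1..length I. 1 / real (length I))"
    unfolding aggregate_def
  proof (rule sum.cong)
    fix t assume "t \<in> {1..length I}"
    then have "Maj I t \<in> set xs"
      using Maj_interleave_const[OF assms(2)] len by (simp add: I_def)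
    then show "freq I (Maj I t) = 1 / real (length I)"
      using assms(2) by (auto simp: freq_eq_count count)
  qed simp
  then have "worst Maj I \<le> 1"
    using worst_le_aggregate[OF refl, of Maj I] len assms(3) by (auto split: if_splits)
  moreover have "2 \<le> worst Eag I"
  proof (rule worst_geI)
    fix J assume J: "mset J = mset I"
    have "real (count (mset J) a) * freq J a \<le> aggregate Eag J"
      by (rule Eag_aggregate_ge) (simp add: J count)
    then have "real (length xs) / 2 \<le> aggregate Eag J"
      using assms(3) len mset_eq_length[OF J] by (auto simp: freq_eq_count J count split: if_splits)
    then show "2 \<le> aggregate Eag J" using assms(3) by linarith
  qed
  ultimately show ?thesis by simp
qed

section \<open>Incomparability\<close>

theorem theorem11:
  assumes "infinite (UNIV :: 'a set)"
  shows "rwo_incomparable (Maj :: 'a algorithm) Eag"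
proof -
  note online = online_Maj[where 'a = 'a] online_Eag[where 'a = 'a]
  have pos: "0 < worst Eag I" if "I \<noteq> []" for I :: "'a list"
    using worst_ge_1[OF online(2) that] by simp
  obtain a :: 'a where "a \<in> UNIV" by simp
  have inf: "infinite (UNIV - {a})" using assms by simp
  obtain b where b: "a \<noteq> b" using infinite_imp_nonempty[OF inf] by fast
  have "\<exists>\<^sub>F n in sequentially. \<exists>I :: 'a list.
      length I = n \<and> 0 < worst Eag I \<and> 2 * worst Eag I \<le> worst Maj I"
    unfolding frequently_sequentially
  proof
    fix N
    let ?I = "b # b # replicate (N + 8) a"
    show "\<exists>n\<ge>N. \<exists>I :: 'a list. length I = n \<and> 0 < worst Eag I \<and> 2 * worst Eag I \<le> worst Maj I"
      using Maj_worst_beats_Eag_worst[OF b, of "N + 8"] pos[of ?I]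
      by (intro exI[of _ "length ?I"] conjI exI[of _ ?I]) auto
  qed
  note upper = limsup_rwo_function_ge[OF _ this]
  have "\<exists>\<^sub>F n in sequentially. \<exists>I :: 'a list.
      length I = n \<and> 0 < worst Eag I \<and> worst Maj I \<le> 1 / 2 * worst Eag I"
    unfolding frequently_sequentially
  proof
    fix N
    \<comment> \<open>The infinite universe supplies arbitrarily many distinct items besides
      \<open>a\<close>; the summand 4 meets the size condition of the family and \<open>N\<close>
      makes the input long enough.\<close>
    obtain X where X: "finite X" "card X = N + 4" "X \<subseteq> UNIV - {a}"
      using infinite_arbitrarily_large[OF inf] by blast
    then obtain xs where xs: "set xs = X" "distinct xs" using finite_distinct_list by blast
    then have len: "length xs = N + 4" using X distinct_card by fastforce
    let ?I = "interleave_const a xs"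
    have "worst Maj ?I \<le> 1 / 2 * worst Eag ?I"
      using xs X len by (intro Eag_worst_beats_Maj_worst) auto
    moreover have "?I \<noteq> []" using len by (cases xs) auto
    ultimately show "\<exists>n\<ge>N. \<exists>I :: 'a list.
        length I = n \<and> 0 < worst Eag I \<and> worst Maj I \<le> 1 / 2 * worst Eag I"
      using pos[of ?I] len
      by (intro exI[of _ "length ?I"] conjI exI[of _ ?I]) (auto simp: length_interleave_const)
  qed
  note lower = liminf_rwo_function_le[OF _ _ this]
  \<comment> \<open>The families force limsup at least 2 and liminf at most 1/2 for all bounding
    functions, so both alternatives of comparability fail.\<close>
  have "\<not> limsup (\<lambda>n. ereal (f n)) \<le> 1"
    if "upper_bounding (Maj :: 'a algorithm) Eag f" for f
  proof
    assume "limsup (\<lambda>n. ereal (f n)) \<le> 1"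
    with upper[of f] that have "ereal 2 \<le> 1" unfolding upper_bounding_def by (meson order_trans)
    then show False by (simp add: one_ereal_def)
  qed
  moreover have "\<not> 1 \<le> liminf (\<lambda>n. ereal (g n))"
    if "lower_bounding (Maj :: 'a algorithm) Eag g" for g
  proof
    assume "1 \<le> liminf (\<lambda>n. ereal (g n))"
    with lower[of g] that have "1 \<le> ereal (1 / 2)"
      unfolding lower_bounding_def by (meson order_trans half_gt_zero_iff zero_less_one)
    then show False by (simp add: one_ereal_def)
  qed
  ultimately have "\<not> rwo_comparable (Maj :: 'a algorithm) Eag"
    unfolding rwo_comparable_def by blast
  then show ?thesis
    using ex_upper_bounding[OF online] ex_lower_bounding[OF online]
    by (simp add: rwo_incomparable_def)
qed

end
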